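(* Let $\mathcal{R}$ be an associative ring with unit $1\neq 0$, let $a,x\in\mathcal{R}$, let $\mathcal{S}$ be a right ideal of $\mathcal{R}$ and let $\mathcal{S}'$ be a left ideal of $\mathcal{R}$. Then the following assertions are equivalent: (1) $x\in a\{1\}$, $xa\mathcal{R}=\mathcal{S}$, and $\mathcal{R}ax=\mathcal{S}'$. (2) $\varphi_{xa}=\rho_{\mathcal{S},\,{\rm rann}(a)}$ and ${}_{ax}\varphi=\rho_{\mathcal{S}',\,{\rm lann}(a)}$. (3) $a\{1\}\neq\emptyset$ and $x=\rho_{\mathcal{S},\,{\rm rann}(a)}(1)\,a^{(1)}\,\rho_{\mathcal{S}',\,{\rm lann}(a)}(1)+(1-a^{(1)}a)\,y\,(1-aa^{(1)})$ for some $a^{(1)}\in a\{1\}$ and some $y\in\mathcal{R}$.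
   Context: For $a\in\mathcal{R}$: $a\{1\}=\{x\in\mathcal{R}: axa=a\}$; $a\mathcal{R}=\{ar:r\in\mathcal{R}\}$, $\mathcal{R}a=\{ra:r\in\mathcal{R}\}$, ${\rm rann}(a)=\{r\in\mathcal{R}:ar=0\}$, ${\rm lann}(a)=\{r\in\mathcal{R}:ra=0\}$. The additive group endomorphisms $\varphi_a,{}_a\varphi:\mathcal{R}\to\mathcal{R}$ are $\varphi_a(r)=ar$ and ${}_a\varphi(r)=ra$. For additive subgroups $\mathcal{S},\mathcal{T}$ of $\mathcal{R}$, $\mathcal{R}=\mathcal{S}\oplus\mathcal{T}$ means $\mathcal{R}=\mathcal{S}+\mathcal{T}$ and $\mathcal{S}\cap\mathcal{T}=\{0\}$; in that case $\rho_{\mathcal{S},\mathcal{T}}:\mathcal{R}\to\mathcal{R}$ is the group endomorphism $\rho_{\mathcal{S},\mathcal{T}}(s+t)=s$ for $s\in\mathcal{S}$, $t\in\mathcal{T}$. Convention: whenever $\rho_{\mathcal{S},\mathcal{T}}$ is written, it is implicitly asserted that $\mathcal{R}=\mathcal{S}\oplus\mathcal{T}$; thus (2) and (3) each include the assertions $\mathcal{R}=\mathcal{S}\oplus{\rm rann}(a)$ and $\mathcal{R}=\mathcal{S}'\oplus{\rm lann}(a)$. *)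

theory Defs
  imports Main "HOL-Library.Set_Algebras"
begin

definition add_subgroup :: "'a::ab_group_add set \<Rightarrow> bool" where
  "add_subgroup S \<longleftrightarrow> 0 \<in> S \<and> (\<forall>s\<in>S. \<forall>t\<in>S. s + t \<in> S) \<and> (\<forall>s\<in>S. - s \<in> S)"

definition right_ideal :: "'a::ring_1 set \<Rightarrow> bool" where
  "right_ideal S \<longleftrightarrow> add_subgroup S \<and> (\<forall>s\<in>S. \<forall>r. s * r \<in> S)"

definition left_ideal :: "'a::ring_1 set \<Rightarrow> bool" where
  "left_ideal S \<longleftrightarrow> add_subgroup S \<and> (\<forall>s\<in>S. \<forall>r. r * s \<in> S)"

definition inner_inverses :: "'a::ring_1 \<Rightarrow> 'a set" where
  "inner_inverses a = {x. a * x * a = a}"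

definition principal_right :: "'a::ring_1 \<Rightarrow> 'a set" where
  "principal_right a = {a * r | r. True}"

definition principal_left :: "'a::ring_1 \<Rightarrow> 'a set" where
  "principal_left a = {r * a | r. True}"

definition rann :: "'a::ring_1 \<Rightarrow> 'a set" where
  "rann a = {r. a * r = 0}"

definition lann :: "'a::ring_1 \<Rightarrow> 'a set" where
  "lann a = {r. r * a = 0}"

definition lmult :: "'a::ring_1 \<Rightarrow> 'a \<Rightarrow> 'a" where
  "lmult a = (\<lambda>r. a * r)"

definition rmult :: "'a::ring_1 \<Rightarrow> 'a \<Rightarrow> 'a" where
  "rmult a = (\<lambda>r. r * a)"

text \<open>The sum of sets is the elementwise one of \<^theory>\<open>HOL-Library.Set_Algebras\<close>.\<close>

definition direct_sum :: "'a::ring_1 set \<Rightarrow> 'a set \<Rightarrow> bool" where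
  "direct_sum S T \<longleftrightarrow> S + T = UNIV \<and> S \<inter> T = {0}"

text \<open>The projection onto \<open>S\<close> along \<open>T\<close>. It is meaningful only for additive subgroups with
  \<^term>\<open>direct_sum S T\<close>, so statements using it assert \<^term>\<open>direct_sum S T\<close> separately.\<close>

definition proj_along :: "'a::ring_1 set \<Rightarrow> 'a set \<Rightarrow> 'a \<Rightarrow> 'a" where
  "proj_along S T r = (THE s. s \<in> S \<and> (\<exists>t\<in>T. r = s + t))"

end

theory Submission
  imports Defs
begin

text \<open>
  A right ideal \<open>S\<close> with \<open>\<R> = S \<oplus> rann a\<close> is the principal right ideal of an idempotent:
  split \<open>1 = e + t\<close> with \<open>e \<in> S\<close> and \<open>a t = 0\<close>.  Since both summands are right ideals,
  multiplying this one equation on the right by \<open>r\<close> splits every \<open>r\<close>, so the projection onto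
  \<open>S\<close> along \<open>rann a\<close> is left multiplication by \<open>e\<close>, its value at \<open>1\<close>.
  The mirror statement gives \<open>f\<close> with right multiplication by \<open>f\<close> as the projection onto \<open>S'\<close>
  along \<open>lann a\<close>.

  All three assertions therefore say the same thing: the two decompositions exist, and
  \<open>e = x a\<close> and \<open>f = a x\<close>.  For the first assertion this is
  \<open>inner_inverse_right_iff\<close> and \<open>inner_inverse_left_iff\<close>; for the second one evaluates the
  projections at \<open>1\<close>; for the third one uses that \<open>x a = e\<close> and \<open>a x = f\<close> is a
  linear system in \<open>x\<close>.  For every inner inverse \<open>b\<close> of \<open>a\<close> the product \<open>e b f\<close> is a
  particular solution, because \<open>f a = a\<close> and \<open>1 - b a \<in> rann a = rann e\<close> give
  \<open>e b f a = e b a = e\<close>, and symmetrically \<open>a e b f = f\<close>; and \<open>(1 - b a) y (1 - a b)\<close> solves the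
  homogeneous system \<open>x a = 0 = a x\<close>.  Conversely a solution \<open>x\<close> is itself an inner inverse
  and is represented by \<open>b = y = x\<close>.
\<close>

text \<open>
  Two decompositions of the same element differ by an element of \<open>S \<inter> T = {0}\<close>, so the definite
  description has a unique witness.
\<close>

lemma proj_along_add:
  assumes S: "add_subgroup S" and T: "add_subgroup T"
    and sum: "direct_sum S T" and s: "s \<in> S" and t: "t \<in> T"
  shows "proj_along S T (s + t) = s"
  unfolding proj_along_def
proof (rule the_equality)
  show "s \<in> S \<and> (\<exists>t'\<in>T. s + t = s + t')"
    using s t by blast
next
  fix u assume "u \<in> S \<and> (\<exists>t'\<in>T. s + t = u + t')"
  then obtain v where u: "u \<in> S" and v: "v \<in> T" and eq: "s + t = u + v"
    by blast
  have "u + - s \<in> S" and "t + - v \<in> T"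
    using S T u s t v unfolding add_subgroup_def by blast+
  moreover have "u + - s = t + - v"
    using eq by (simp add: algebra_simps)
  ultimately have "u + - s = 0"
    using sum unfolding direct_sum_def by (metis IntI singletonD)
  then show "u = s"
    by simp
qed

section \<open>Complements of a right annihilator\<close>

lemma add_subgroup_rann: "add_subgroup (rann a)"
  unfolding add_subgroup_def rann_def by (simp add: algebra_simps)

text \<open>
  The annihilator of \<open>a\<close> is itself a right ideal, so \<open>1 = e + t\<close> with \<open>e \<in> S\<close> and \<open>a t = 0\<close>
  gives \<open>r = e r + t r\<close> with the summands still in \<open>S\<close> and in the annihilator.
\<close>

lemma proj_along_rann:
  assumes S: "right_ideal S" and sum: "direct_sum S (rann a)"
  shows "proj_along S (rann a) 1 \<in> S"
    and "a * proj_along S (rann a) 1 = a"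
    and "proj_along S (rann a) = lmult (proj_along S (rann a) 1)"
proof -
  have sub: "add_subgroup S"
    using S unfolding right_ideal_def by blast
  have "1 \<in> S + rann a"
    using sum unfolding direct_sum_def by simp
  then obtain e t where e: "e \<in> S" and t: "a * t = 0" and one: "1 = e + t"
    unfolding rann_def by (auto elim: set_plus_elim)
  have split: "proj_along S (rann a) r = e * r" for r
  proof -
    have "e * r \<in> S"
      using S e unfolding right_ideal_def by blast
    moreover have "t * r \<in> rann a"
      using t unfolding rann_def by (simp flip: mult.assoc)
    moreover have "r = e * r + t * r"
      using one by (simp flip: distrib_right)
    ultimately show ?thesis
      using proj_along_add[OF sub add_subgroup_rann sum] by metis
  qed
  have one_eq: "proj_along S (rann a) 1 = e"
    by (simp add: split)
  have "a * (e + t) = a * e"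
    using t by (simp add: distrib_left)
  then have "a * e = a"
    by (simp flip: one)
  then show "proj_along S (rann a) 1 \<in> S"
    and "a * proj_along S (rann a) 1 = a"
    and "proj_along S (rann a) = lmult (proj_along S (rann a) 1)"
    using e split by (simp_all add: one_eq lmult_def fun_eq_iff)
qed

text \<open>
  The right-hand side mentions no projection, so it can be tested on a given \<open>e\<close>.  It forces \<open>e\<close>
  to be idempotent: \<open>a e = a\<close> puts \<open>1 - e\<close> into the annihilator of \<open>a\<close>, hence into that of \<open>e\<close>.
  Then \<open>r = e r + (1 - e) r\<close> is the decomposition of \<open>r\<close>.
\<close>

lemma direct_sum_rann_iff:
  assumes S: "right_ideal S"
  shows "direct_sum S (rann a) \<and> proj_along S (rann a) 1 = e \<longleftrightarrow>
    principal_right e = S \<and> a * e = a \<and> rann a \<subseteq> rann e"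
    (is "?sum \<longleftrightarrow> ?gen")
proof
  assume ?sum
  then have sum: "direct_sum S (rann a)" and e: "e = proj_along S (rann a) 1"
    by simp_all
  have sub: "add_subgroup S"
    using S unfolding right_ideal_def by blast
  have proj: "proj_along S (rann a) r = e * r" for r
    using proj_along_rann(3)[OF S sum] unfolding e lmult_def by metis
  have "e \<in> S" and ae: "a * e = a"
    using proj_along_rann(1,2)[OF S sum] by (simp_all add: e)
  then have "principal_right e \<subseteq> S"
    using S unfolding principal_right_def right_ideal_def by auto
  moreover have "S \<subseteq> principal_right e"
  proof
    fix s assume "s \<in> S"
    then have "e * s = s"
      using proj_along_add[OF sub add_subgroup_rann sum, of s 0] add_subgroup_rann[of a]
      by (simp add: proj add_subgroup_def)
    then show "s \<in> principal_right e"
      unfolding principal_right_def by (metis (mono_tags, lifting) mem_Collect_eq)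
  qed
  moreover have "rann a \<subseteq> rann e"
  proof
    fix t assume "t \<in> rann a"
    moreover have "0 \<in> S"
      using sub unfolding add_subgroup_def by blast
    ultimately have "e * t = 0"
      using proj_along_add[OF sub add_subgroup_rann sum, of 0 t]
      by (simp add: proj)
    then show "t \<in> rann e"
      by (simp add: rann_def)
  qed
  ultimately show ?gen
    using ae by blast
next
  assume ?gen
  then have gen: "S = principal_right e" and ae: "a * e = a" and sub_ann: "rann a \<subseteq> rann e"
    by simp_all
  have sub: "add_subgroup S"
    using S unfolding right_ideal_def by blast
  have in_S: "e * r \<in> S" for r
    unfolding gen principal_right_def by blast
  have in_ann: "r - e * r \<in> rann a" for r
    using ae unfolding rann_def by (simp add: right_diff_distrib left_diff_distrib flip: mult.assoc)
  have "r \<in> S + rann a" for r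
    using set_plus_intro[OF in_S in_ann, of r r] by simp
  moreover have "s = 0" if s: "s \<in> S" "s \<in> rann a" for s
  proof -
    obtain r where r: "s = e * r"
      using s(1) unfolding gen principal_right_def by blast
    \<comment> \<open>\<open>a * s = 0\<close> and \<open>a * e = a\<close> bring the annihilation from \<open>s\<close> back to \<open>r\<close>.\<close>
    have "a * r = 0"
      using s(2) ae unfolding rann_def r by (simp flip: mult.assoc)
    then show "s = 0"
      using sub_ann unfolding rann_def r by blast
  qed
  moreover have "0 \<in> S" and "0 \<in> rann a"
    using sub add_subgroup_rann unfolding add_subgroup_def by blast+
  ultimately have sum: "direct_sum S (rann a)"
    unfolding direct_sum_def by blast
  have "proj_along S (rann a) 1 = e"
    using proj_along_add[OF sub add_subgroup_rann sum in_S in_ann, of 1 1] by simp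
  with sum show ?sum
    by blast
qed

text \<open>
  For \<open>e = x a\<close> the inclusion of annihilators is automatic and \<open>a e = a\<close> says that
  \<open>x\<close> is an inner inverse.
\<close>

lemma inner_inverse_right_iff:
  assumes S: "right_ideal S"
  shows "x \<in> inner_inverses a \<and> principal_right (x * a) = S \<longleftrightarrow>
    direct_sum S (rann a) \<and> proj_along S (rann a) 1 = x * a"
proof -
  have "rann a \<subseteq> rann (x * a)"
    unfolding rann_def by (auto simp: mult.assoc)
  moreover have "x \<in> inner_inverses a \<longleftrightarrow> a * (x * a) = a"
    unfolding inner_inverses_def by (simp add: mult.assoc)
  ultimately show ?thesis
    using direct_sum_rann_iff[OF S] by blast
qed

section \<open>Complements of a left annihilator\<close>

text \<open>
  The results on right annihilators hold here by the same arguments, read in the opposite ring: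
  every product changes its order, and the projection becomes a right multiplication.
\<close>

lemma add_subgroup_lann: "add_subgroup (lann a)"
  unfolding add_subgroup_def lann_def by (simp add: algebra_simps)

lemma proj_along_lann:
  assumes S: "left_ideal S" and sum: "direct_sum S (lann a)"
  shows "proj_along S (lann a) 1 \<in> S"
    and "proj_along S (lann a) 1 * a = a"
    and "proj_along S (lann a) = rmult (proj_along S (lann a) 1)"
proof -
  have sub: "add_subgroup S"
    using S unfolding left_ideal_def by blast
  have "1 \<in> S + lann a"
    using sum unfolding direct_sum_def by simp
  then obtain e t where e: "e \<in> S" and t: "t * a = 0" and one: "1 = e + t"
    unfolding lann_def by (auto elim: set_plus_elim)
  have split: "proj_along S (lann a) r = r * e" for r
  proof -
    have "r * e \<in> S"
      using S e unfolding left_ideal_def by blast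
    moreover have "r * t \<in> lann a"
      using t unfolding lann_def by (simp add: mult.assoc)
    moreover have "r = r * e + r * t"
      using one by (simp flip: distrib_left)
    ultimately show ?thesis
      using proj_along_add[OF sub add_subgroup_lann sum] by metis
  qed
  have one_eq: "proj_along S (lann a) 1 = e"
    by (simp add: split)
  have "(e + t) * a = e * a"
    using t by (simp add: distrib_right)
  then have "e * a = a"
    by (simp flip: one)
  then show "proj_along S (lann a) 1 \<in> S"
    and "proj_along S (lann a) 1 * a = a"
    and "proj_along S (lann a) = rmult (proj_along S (lann a) 1)"
    using e split by (simp_all add: one_eq rmult_def fun_eq_iff)
qed

lemma direct_sum_lann_iff:
  assumes S: "left_ideal S"
  shows "direct_sum S (lann a) \<and> proj_along S (lann a) 1 = e \<longleftrightarrow>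
    principal_left e = S \<and> e * a = a \<and> lann a \<subseteq> lann e"
    (is "?sum \<longleftrightarrow> ?gen")
proof
  assume ?sum
  then have sum: "direct_sum S (lann a)" and e: "e = proj_along S (lann a) 1"
    by simp_all
  have sub: "add_subgroup S"
    using S unfolding left_ideal_def by blast
  have proj: "proj_along S (lann a) r = r * e" for r
    using proj_along_lann(3)[OF S sum] unfolding e rmult_def by metis
  have "e \<in> S" and ae: "e * a = a"
    using proj_along_lann(1,2)[OF S sum] by (simp_all add: e)
  then have "principal_left e \<subseteq> S"
    using S unfolding principal_left_def left_ideal_def by auto
  moreover have "S \<subseteq> principal_left e"
  proof
    fix s assume "s \<in> S"
    then have "s * e = s"
      using proj_along_add[OF sub add_subgroup_lann sum, of s 0] add_subgroup_lann[of a]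
      by (simp add: proj add_subgroup_def)
    then show "s \<in> principal_left e"
      unfolding principal_left_def by (metis (mono_tags, lifting) mem_Collect_eq)
  qed
  moreover have "lann a \<subseteq> lann e"
  proof
    fix t assume "t \<in> lann a"
    moreover have "0 \<in> S"
      using sub unfolding add_subgroup_def by blast
    ultimately have "t * e = 0"
      using proj_along_add[OF sub add_subgroup_lann sum, of 0 t]
      by (simp add: proj)
    then show "t \<in> lann e"
      by (simp add: lann_def)
  qed
  ultimately show ?gen
    using ae by blast
next
  assume ?gen
  then have gen: "S = principal_left e" and ae: "e * a = a" and sub_ann: "lann a \<subseteq> lann e"
    by simp_all
  have sub: "add_subgroup S"
    using S unfolding left_ideal_def by blast
  have in_S: "r * e \<in> S" for r
    unfolding gen principal_left_def by blast
  have in_ann: "r - r * e \<in> lann a" for r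
    using ae unfolding lann_def by (simp add: left_diff_distrib right_diff_distrib mult.assoc)
  have "r \<in> S + lann a" for r
    using set_plus_intro[OF in_S in_ann, of r r] by simp
  moreover have "s = 0" if s: "s \<in> S" "s \<in> lann a" for s
  proof -
    obtain r where r: "s = r * e"
      using s(1) unfolding gen principal_left_def by blast
    \<comment> \<open>\<open>s * a = 0\<close> and \<open>e * a = a\<close> bring the annihilation from \<open>s\<close> back to \<open>r\<close>.\<close>
    have "r * a = 0"
      using s(2) ae unfolding lann_def r by (simp add: mult.assoc)
    then show "s = 0"
      using sub_ann unfolding lann_def r by blast
  qed
  moreover have "0 \<in> S" and "0 \<in> lann a"
    using sub add_subgroup_lann unfolding add_subgroup_def by blast+
  ultimately have sum: "direct_sum S (lann a)"
    unfolding direct_sum_def by blast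
  have "proj_along S (lann a) 1 = e"
    using proj_along_add[OF sub add_subgroup_lann sum in_S in_ann, of 1 1] by simp
  with sum show ?sum
    by blast
qed

lemma inner_inverse_left_iff:
  assumes S: "left_ideal S"
  shows "x \<in> inner_inverses a \<and> principal_left (a * x) = S \<longleftrightarrow>
    direct_sum S (lann a) \<and> proj_along S (lann a) 1 = a * x"
proof -
  have "lann a \<subseteq> lann (a * x)"
    unfolding lann_def by (auto simp flip: mult.assoc)
  moreover have "x \<in> inner_inverses a \<longleftrightarrow> (a * x) * a = a"
    unfolding inner_inverses_def by (simp add: mult.assoc)
  ultimately show ?thesis
    using direct_sum_lann_iff[OF S] by blast
qed

section \<open>Inner inverses with prescribed ideals\<close>

theorem theorem4p3:
  fixes a x :: "'a::ring_1" and S S' :: "'a set"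
  assumes "right_ideal S" and "left_ideal S'"
  shows
    "((x \<in> inner_inverses a \<and> principal_right (x * a) = S \<and> principal_left (a * x) = S')
      \<longleftrightarrow>
      (direct_sum S (rann a) \<and> lmult (x * a) = proj_along S (rann a) \<and>
       direct_sum S' (lann a) \<and> rmult (a * x) = proj_along S' (lann a)))
     \<and>
     ((x \<in> inner_inverses a \<and> principal_right (x * a) = S \<and> principal_left (a * x) = S')
      \<longleftrightarrow>
      (inner_inverses a \<noteq> {} \<and> direct_sum S (rann a) \<and> direct_sum S' (lann a) \<and>
       (\<exists>b\<in>inner_inverses a. \<exists>y.
          x = proj_along S (rann a) 1 * b * proj_along S' (lann a) 1
              + (1 - b * a) * y * (1 - a * b))))"
  (is "(?one \<longleftrightarrow> ?two) \<and> (?one \<longleftrightarrow> ?three)")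
proof -
  let ?e = "proj_along S (rann a) 1" and ?f = "proj_along S' (lann a) 1"
  let ?sums = "direct_sum S (rann a) \<and> direct_sum S' (lann a)"
  have one: "?one \<longleftrightarrow> ?sums \<and> ?e = x * a \<and> ?f = a * x"
    using inner_inverse_right_iff[OF assms(1)] inner_inverse_left_iff[OF assms(2)] by blast
  have "lmult (x * a) = proj_along S (rann a) \<longleftrightarrow> ?e = x * a" if "direct_sum S (rann a)"
    using proj_along_rann(3)[OF assms(1) that] unfolding lmult_def by (metis mult.right_neutral)
  moreover have "rmult (a * x) = proj_along S' (lann a) \<longleftrightarrow> ?f = a * x"
    if "direct_sum S' (lann a)"
    using proj_along_lann(3)[OF assms(2) that] unfolding rmult_def by (metis mult.left_neutral)
  ultimately have two: "?two \<longleftrightarrow> ?sums \<and> ?e = x * a \<and> ?f = a * x"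
    by blast
  have three: "?three \<longleftrightarrow> ?sums \<and> ?e = x * a \<and> ?f = a * x"
  proof
    assume rhs: "?sums \<and> ?e = x * a \<and> ?f = a * x"
    then have x: "x \<in> inner_inverses a"
      using one by blast
    \<comment> \<open>Both parameters may be \<open>x\<close>: the formula is then \<open>x = x a x + (x - x a x)\<close>.\<close>
    have "x = ?e * x * ?f + (1 - x * a) * x * (1 - a * x)"
    proof -
      \<comment> \<open>\<open>a x a = a\<close> in the form that rewrites inside right-nested products.\<close>
      have "a * (x * (a * z)) = a * z" for z
        using x unfolding inner_inverses_def by (metis (mono_tags) mem_Collect_eq mult.assoc)
      then show ?thesis
        using rhs by (simp add: algebra_simps)
    qed
    then show ?three
      using x rhs by blast
  next
    assume ?three
    then have sums: ?sums by blast
    from \<open>?three\<close> obtain b y where b: "a * b * a = a"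
      and x: "x = ?e * b * ?f + (1 - b * a) * y * (1 - a * b)"
      unfolding inner_inverses_def by blast
    have "?f * a = a" and "a * ?e = a"
      using proj_along_lann(2)[OF assms(2)] proj_along_rann(2)[OF assms(1)] sums by blast+
    have "1 - b * a \<in> rann a" and "1 - a * b \<in> lann a"
      using b unfolding rann_def lann_def by (simp_all add: algebra_simps)
    then have "?e * (1 - b * a) = 0" and "(1 - a * b) * ?f = 0"
      using direct_sum_rann_iff[OF assms(1), of a ?e] direct_sum_lann_iff[OF assms(2), of a ?f] sums
      unfolding rann_def lann_def by blast+
    then have eb: "?e * b * a = ?e" and bf: "a * b * ?f = ?f"
      by (simp_all add: algebra_simps)
    have "x * a = ?e * b * (?f * a) + (1 - b * a) * y * ((1 - a * b) * a)"
      by (subst x) (simp only: distrib_right mult.assoc)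
    also have "(1 - a * b) * a = 0"
      using b by (simp add: left_diff_distrib)
    finally have xa: "x * a = ?e"
      using \<open>?f * a = a\<close> eb by simp
    have "a * x = a * ?e * b * ?f + a * (1 - b * a) * y * (1 - a * b)"
      by (subst x) (simp only: distrib_left mult.assoc)
    also have "a * (1 - b * a) = 0"
      using b by (simp add: right_diff_distrib mult.assoc)
    finally have ax: "a * x = ?f"
      using \<open>a * ?e = a\<close> bf by simp
    show "?sums \<and> ?e = x * a \<and> ?f = a * x"
      using sums xa ax by simp
  qed
  show ?thesis
    using one two three by blast
qed

end
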